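(* Let $L\subseteq\Sigma^*$ be a regular language. The state-minimal $\mathsf{JSL}$-dfa $\mathfrak{dfa}(L)$ is isomorphic to the determinisation of the canonical dependency automaton of $L$, via the $\mathsf{JSL}$-dfa isomorphism $$\alpha:\mathfrak{dfa}(L)\to\mathrm{Det}(\mathbf{dfa}(L),\mathcal{DR}_L,\mathbf{dfa}(L^r)),$$ $$\alpha(X):=\{v^{-1}L^r:v\in X^r\},\qquad \alpha^{-1}(Y):=\Big[\Big(\bigcap Y\Big)^r\Big]^{-1}L .$$
   Context: Fix an alphabet $\Sigma$. $X^r$ is the set of reversals of words of $X\subseteq\Sigma^*$. $U^{-1}L=\{w\in\Sigma^*:\exists u\in U.\,uw\in L\}$ for $U\subseteq\Sigma^*$, and $u^{-1}L=\{u\}^{-1}L$. $\mathsf{LW}(L)=\{u^{-1}L:u\in\Sigma^*\}$ and $\mathsf{LQ}(L)=\{U^{-1}L:U\subseteq\Sigma^*\}$ (both finite since $L$ is regular). For a set $Y$ of languages, $\bigcap Y$ is their intersection (the empty intersection is $\Sigma^*$). A $\mathsf{JSL}$-dfa is $(s_0,\mathbb S,\delta_a,F)$ with $\mathbb S$ a finite join-semilattice (with bottom), $s_0\in S$, $\delta_a$ ($a\in\Sigma$) endomorphisms preserving all finite joins, and $F=\{s:s\nleq_{\mathbb S}t\}$ for some $t\in S$. A morphism $(s_0,\mathbb S,\gamma_a,F)\to(t_0,\mathbb T,\delta_a,F')$ is a function $f$ preserving all finite joins with $f(s_0)=t_0$, $f\circ\gamma_a=\delta_a\circ f$ and $f^{-1}(F')=F$.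 $\mathfrak{dfa}(L):=(L,(\mathsf{LQ}(L),\cup,\emptyset),\lambda X.a^{-1}X,\{X\in\mathsf{LQ}(L):\varepsilon\in X\})$ is the state-minimal $\mathsf{JSL}$-dfa accepting $L$. $\mathbf{dfa}(L)$ is the state-minimal classical dfa with states $\mathsf{LW}(L)$, initial state $L$, transitions $X\mapsto a^{-1}X$, final states $\{X:\varepsilon\in X\}$. The dependency relation $\mathcal{DR}_L\subseteq\mathsf{LW}(L)\times\mathsf{LW}(L^r)$ is $\mathcal{DR}_L(u^{-1}L,v^{-1}L^r)\iff uv^r\in L$. The triple $(\mathbf{dfa}(L),\mathcal{DR}_L,\mathbf{dfa}(L^r))$ is the canonical dependency automaton of $L$. Its determinisation $\mathrm{Det}(\mathbf{dfa}(L),\mathcal{DR}_L,\mathbf{dfa}(L^r))$ is the $\mathsf{JSL}$-dfa whose states are the sets $\mathcal{DR}_L[A]=\{y:\exists x\in A.\,\mathcal{DR}_L(x,y)\}$ for $A\subseteq\mathsf{LW}(L)$, with joins given by union and bottom $\emptyset$, whose initial state is $\{Z\in\mathsf{LW}(L^r):\varepsilon\in Z\}$, whose transitions are $S\mapsto\{Z\in\mathsf{LW}(L^r):a^{-1}Z\in S\}$, and whose final states are those $S$ with $L^r\in S$.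
   Formalization: The printed formula for the inverse of α fails for every nonempty L (take Y = ∅); it is replaced by [(⋂ of the complements of those Z in LW(L^r) that are not in Y)^r]^{-1} L, and everything else is as stated. *)

theory Defs
  imports Main
begin

type_synonym 'a lang = "'a list set"

definition left_quot :: "'a lang \<Rightarrow> 'a lang \<Rightarrow> 'a lang" where
  "left_quot U L = {w. \<exists>u\<in>U. u @ w \<in> L}"

definition left_deriv :: "'a list \<Rightarrow> 'a lang \<Rightarrow> 'a lang" where
  "left_deriv u L = left_quot {u} L"

definition LW :: "'a lang \<Rightarrow> 'a lang set" where
  "LW L = {left_deriv u L | u. True}"

definition LQ :: "'a lang \<Rightarrow> 'a lang set" where
  "LQ L = {left_quot U L | U. True}"

definition reversal :: "'a lang \<Rightarrow> 'a lang" where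
  "reversal L = rev ` L"

record ('s, 'a) dfa =
  dfa_states :: "'s set"
  dfa_init :: 's
  dfa_step :: "'a \<Rightarrow> 's \<Rightarrow> 's"
  dfa_final :: "'s set"

definition is_dfa :: "('s, 'a) dfa \<Rightarrow> bool" where
  "is_dfa M \<longleftrightarrow>
     finite (dfa_states M) \<and> dfa_init M \<in> dfa_states M \<and>
     (\<forall>a. \<forall>q \<in> dfa_states M. dfa_step M a q \<in> dfa_states M) \<and>
     dfa_final M \<subseteq> dfa_states M"

definition dfa_lang :: "('s, 'a) dfa \<Rightarrow> 'a lang" where
  "dfa_lang M = {w. fold (dfa_step M) w (dfa_init M) \<in> dfa_final M}"

(* States of type nat are no restriction: every finite set of states can be renamed into nat. *)
definition regular :: "'a lang \<Rightarrow> bool" where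
  "regular L \<longleftrightarrow> (\<exists>M :: (nat, 'a) dfa. is_dfa M \<and> dfa_lang M = L)"

definition min_dfa :: "'a lang \<Rightarrow> ('a lang, 'a) dfa" where
  "min_dfa L =
     \<lparr> dfa_states = LW L,
       dfa_init = L,
       dfa_step = (\<lambda>a X. left_deriv [a] X),
       dfa_final = {X \<in> LW L. [] \<in> X} \<rparr>"

record ('s, 'a) jsl_dfa =
  jsl_states :: "'s set"
  jsl_join :: "'s \<Rightarrow> 's \<Rightarrow> 's"
  jsl_bot :: 's
  jsl_init :: 's
  jsl_step :: "'a \<Rightarrow> 's \<Rightarrow> 's"
  jsl_final :: "'s set"

definition is_jsl :: "'s set \<Rightarrow> ('s \<Rightarrow> 's \<Rightarrow> 's) \<Rightarrow> 's \<Rightarrow> bool" where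
  "is_jsl S join b \<longleftrightarrow>
     b \<in> S \<and>
     (\<forall>x\<in>S. \<forall>y\<in>S. join x y \<in> S) \<and>
     (\<forall>x\<in>S. \<forall>y\<in>S. \<forall>z\<in>S. join (join x y) z = join x (join y z)) \<and>
     (\<forall>x\<in>S. \<forall>y\<in>S. join x y = join y x) \<and>
     (\<forall>x\<in>S. join x x = x) \<and>
     (\<forall>x\<in>S. join b x = x)"

(* Preservation of all finite joins is preservation of the empty join and of binary joins. *)
definition jsl_hom ::
  "'s set \<Rightarrow> ('s \<Rightarrow> 's \<Rightarrow> 's) \<Rightarrow> 's \<Rightarrow> 't set \<Rightarrow> ('t \<Rightarrow> 't \<Rightarrow> 't) \<Rightarrow> 't \<Rightarrow> ('s \<Rightarrow> 't) \<Rightarrow> bool" where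
  "jsl_hom S joinS bS T joinT bT f \<longleftrightarrow>
     (\<forall>x\<in>S. f x \<in> T) \<and> f bS = bT \<and>
     (\<forall>x\<in>S. \<forall>y\<in>S. f (joinS x y) = joinT (f x) (f y))"

(* The order of the semilattice is s \<le> t iff join s t = t. *)
definition is_jsl_dfa :: "('s, 'a) jsl_dfa \<Rightarrow> bool" where
  "is_jsl_dfa A \<longleftrightarrow>
     finite (jsl_states A) \<and>
     is_jsl (jsl_states A) (jsl_join A) (jsl_bot A) \<and>
     jsl_init A \<in> jsl_states A \<and>
     (\<forall>a. jsl_hom (jsl_states A) (jsl_join A) (jsl_bot A)
                  (jsl_states A) (jsl_join A) (jsl_bot A) (jsl_step A a)) \<and>
     (\<exists>t \<in> jsl_states A. jsl_final A = {s \<in> jsl_states A. jsl_join A s t \<noteq> t})"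

definition jsl_dfa_morphism ::
  "('s, 'a) jsl_dfa \<Rightarrow> ('t, 'a) jsl_dfa \<Rightarrow> ('s \<Rightarrow> 't) \<Rightarrow> bool" where
  "jsl_dfa_morphism A B f \<longleftrightarrow>
     jsl_hom (jsl_states A) (jsl_join A) (jsl_bot A)
             (jsl_states B) (jsl_join B) (jsl_bot B) f \<and>
     f (jsl_init A) = jsl_init B \<and>
     (\<forall>a. \<forall>s \<in> jsl_states A. f (jsl_step A a s) = jsl_step B a (f s)) \<and>
     {s \<in> jsl_states A. f s \<in> jsl_final B} = jsl_final A"

definition jsl_dfa_iso ::
  "('s, 'a) jsl_dfa \<Rightarrow> ('t, 'a) jsl_dfa \<Rightarrow> ('s \<Rightarrow> 't) \<Rightarrow> ('t \<Rightarrow> 's) \<Rightarrow> bool" where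
  "jsl_dfa_iso A B f g \<longleftrightarrow>
     jsl_dfa_morphism A B f \<and> jsl_dfa_morphism B A g \<and>
     (\<forall>s \<in> jsl_states A. g (f s) = s) \<and>
     (\<forall>t \<in> jsl_states B. f (g t) = t)"

definition min_jsl_dfa :: "'a lang \<Rightarrow> ('a lang, 'a) jsl_dfa" where
  "min_jsl_dfa L =
     \<lparr> jsl_states = LQ L,
       jsl_join = (\<union>),
       jsl_bot = {},
       jsl_init = L,
       jsl_step = (\<lambda>a X. left_deriv [a] X),
       jsl_final = {X \<in> LQ L. [] \<in> X} \<rparr>"

(* Membership of u @ rev v in L depends only on the two derivatives and not on the
   representatives u and v, so the existential quantification is harmless. *)
definition dep_rel :: "'a lang \<Rightarrow> ('a lang \<times> 'a lang) set" where
  "dep_rel L = {(left_deriv u L, left_deriv v (reversal L)) | u v. u @ rev v \<in> L}"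

type_synonym ('p, 'q, 'a) dep_aut = "('p, 'a) dfa \<times> ('p \<times> 'q) set \<times> ('q, 'a) dfa"

definition canonical_dep_aut :: "'a lang \<Rightarrow> ('a lang, 'a lang, 'a) dep_aut" where
  "canonical_dep_aut L = (min_dfa L, dep_rel L, min_dfa (reversal L))"

(* For the canonical dependency automaton the initial state is {Z \<in> LW L'. [] \<in> Z}, the
   transition along a is S \<mapsto> {Z \<in> LW L'. left_deriv [a] Z \<in> S}, and S is final iff L' \<in> S,
   where L' = reversal L. *)
definition Det :: "('p, 'q, 'a) dep_aut \<Rightarrow> ('q set, 'a) jsl_dfa" where
  "Det D = (case D of (M, R, N) \<Rightarrow>
     (let Q = {R `` A | A. A \<subseteq> dfa_states M} in
      \<lparr> jsl_states = Q,
        jsl_join = (\<union>),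
        jsl_bot = {},
        jsl_init = dfa_final N,
        jsl_step = (\<lambda>a S. {z \<in> dfa_states N. dfa_step N a z \<in> S}),
        jsl_final = {S \<in> Q. dfa_init N \<in> S} \<rparr>))"

definition alpha :: "'a lang \<Rightarrow> 'a lang \<Rightarrow> 'a lang set" where
  "alpha L X = {left_deriv v (reversal L) | v. v \<in> reversal X}"

(* The intersection ranges over the complements of the derivatives of reversal L that are
   missing from Y.  Intersecting the members of Y themselves does not invert alpha: for Y = {}
   this would give left_quot UNIV L, which is nonempty unless L is empty, whereas
   alpha L {} = {}. *)
definition alpha_inv :: "'a lang \<Rightarrow> 'a lang set \<Rightarrow> 'a lang" where
  "alpha_inv L Y = left_quot (reversal (\<Inter>Z \<in> LW (reversal L) - Y. - Z)) L"

end

theory Submission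
  imports Defs
begin

text \<open>The words \<open>rev v\<close> and \<open>rev w\<close> are indistinguishable by the quotients of \<open>L\<close> as soon as
  \<open>v\<close> and \<open>w\<close> have the same derivative of \<open>L\<^sup>r\<close>. Hence \<open>X \<in> LQ L\<close> can be read off \<open>\<alpha> X\<close>, and
  \<open>\<alpha>\<close> is a bijection onto the images of \<open>\<D>\<R>\<^sub>L\<close>, because \<open>\<alpha> (U\<inverse>L)\<close> is the image of
  \<open>{u\<inverse>L | u \<in> U}\<close>. The inverse sends \<open>\<alpha> X\<close> to the union of all derivatives of \<open>L\<close> contained in
  \<open>X\<close>, which is \<open>X\<close>. The remaining structure is transported along this bijection.\<close>

lemma left_deriv_iff [simp]: "w \<in> left_deriv u L \<longleftrightarrow> u @ w \<in> L"
  by (simp add: left_deriv_def left_quot_def)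

lemma left_quot_iff: "w \<in> left_quot U L \<longleftrightarrow> (\<exists>u\<in>U. u @ w \<in> L)"
  by (simp add: left_quot_def)

lemma reversal_iff [simp]: "w \<in> reversal X \<longleftrightarrow> rev w \<in> X"
  unfolding reversal_def by (metis image_iff rev_rev_ident)

lemma left_deriv_Nil [simp]: "left_deriv [] L = L"
  by auto

lemma left_deriv_append: "left_deriv v (left_deriv u L) = left_deriv (u @ v) L"
  by auto

lemma left_deriv_left_quot: "left_deriv v (left_quot U L) = left_quot ((\<lambda>u. u @ v) ` U) L"
  by (auto simp: left_quot_iff)

lemma left_quot_eq_Union: "left_quot U L = \<Union> ((\<lambda>u. left_deriv u L) ` U)"
  by (auto simp: left_quot_iff)

lemma left_quot_in_LQ [simp]: "left_quot U L \<in> LQ L"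
  by (auto simp: LQ_def)

lemma in_LQ_E: assumes "X \<in> LQ L" obtains U where "X = left_quot U L"
  using assms by (auto simp: LQ_def)

lemma left_deriv_in_LW [simp]: "left_deriv u L \<in> LW L"
  by (auto simp: LW_def)

lemma fold_dfa_step_in_states:
  assumes "is_dfa M" "q \<in> dfa_states M"
  shows "fold (dfa_step M) w q \<in> dfa_states M"
  using assms(2) by (induction w arbitrary: q) (use assms(1) in \<open>auto simp: is_dfa_def\<close>)

text \<open>The derivative of \<open>L\<close> by \<open>u\<close> is the language accepted from the
  state that \<open>M\<close> reaches on \<open>u\<close>, so there are at most as many derivatives
  as states.\<close>

lemma finite_LW:
  assumes "regular L"
  shows "finite (LW L)"
proof -
  obtain M :: "(nat, 'a) dfa" where M: "is_dfa M" "dfa_lang M = L"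
    using assms by (auto simp: regular_def)
  define f where "f q = {w. fold (dfa_step M) w q \<in> dfa_final M}" for q
  have "left_deriv u L = f (fold (dfa_step M) u (dfa_init M))" for u
    using M(2) by (auto simp: f_def dfa_lang_def)
  moreover have "fold (dfa_step M) u (dfa_init M) \<in> dfa_states M" for u
    using M(1) by (intro fold_dfa_step_in_states) (auto simp: is_dfa_def)
  ultimately have "LW L \<subseteq> f ` dfa_states M"
    by (auto simp: LW_def)
  moreover have "finite (dfa_states M)"
    using M(1) by (simp add: is_dfa_def)
  ultimately show ?thesis
    using finite_surj by blast
qed

text \<open>Every quotient is a union of derivatives, and a finite set of derivatives has only
  finitely many subsets.\<close>

lemma finite_LQ:
  assumes "regular L"
  shows "finite (LQ L)"
proof -
  have "LQ L \<subseteq> Union ` Pow (LW L)"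
    by (auto simp: LQ_def LW_def left_quot_eq_Union)
  then show ?thesis
    using finite_LW[OF assms] by (meson finite_Pow_iff finite_surj)
qed

lemma is_jsl_dfa_min_jsl_dfa:
  assumes "regular L"
  shows "is_jsl_dfa (min_jsl_dfa L)"
proof -
  have empty: "{} \<in> LQ L"
    using left_quot_in_LQ[of "{}" L] by (simp add: left_quot_def)
  have init: "L \<in> LQ L"
    using left_quot_in_LQ[of "{[]}" L] by (simp add: left_quot_def)
  have un: "X \<union> Y \<in> LQ L" if XY: "X \<in> LQ L" "Y \<in> LQ L" for X Y
  proof -
    obtain U V where "X = left_quot U L" "Y = left_quot V L"
      using XY by (metis in_LQ_E)
    then have "X \<union> Y = left_quot (U \<union> V) L"
      by (auto simp: left_quot_iff)
    then show ?thesis by simp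
  qed
  have step: "left_deriv [a] X \<in> LQ L" if "X \<in> LQ L" for a X
    using that by (auto elim!: in_LQ_E simp: left_deriv_left_quot)
  have step_un: "left_deriv [a] (X \<union> Y) = left_deriv [a] X \<union> left_deriv [a] Y" for a and X Y :: "'a lang"
    by auto
  have step_empty: "left_deriv [a] {} = {}" for a :: 'a
    by auto
  \<comment> \<open>The largest quotient without the empty word is \<open>(- L)\<inverse>L\<close>.\<close>
  have final: "[] \<in> X \<longleftrightarrow> X \<union> left_quot (- L) L \<noteq> left_quot (- L) L" if X: "X \<in> LQ L" for X
  proof -
    obtain U where U: "X = left_quot U L"
      using X by (rule in_LQ_E)
    show ?thesis
    proof (cases "[] \<in> X")
      case True
      moreover have "[] \<notin> left_quot (- L) L" by (simp add: left_quot_iff)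
      ultimately show ?thesis by blast
    next
      case False
      \<comment> \<open>A word of \<open>U\<close> lying in \<open>L\<close> would put the empty
        word into \<open>X\<close>.\<close>
      then have "U \<subseteq> - L" by (auto simp: U left_quot_iff)
      then have "X \<subseteq> left_quot (- L) L" unfolding U left_quot_def by blast
      then show ?thesis using False by auto
    qed
  qed
  have "\<exists>t\<in>LQ L. {X \<in> LQ L. [] \<in> X} = {X \<in> LQ L. X \<union> t \<noteq> t}"
    using final by (intro bexI[of _ "left_quot (- L) L"]) auto
  then show ?thesis
    using finite_LQ[OF assms] empty init un step
    by (auto simp: is_jsl_dfa_def min_jsl_dfa_def is_jsl_def jsl_hom_def step_un step_empty Un_ac)
qed

text \<open>This spares a direct check of the axioms for \<open>B\<close>: every state of
  \<open>B\<close> is an image under \<open>f\<close>, so the laws carry over from \<open>A\<close>.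
  The assumption \<open>final\<close> excludes final elements outside the states, which a morphism
  does not constrain.\<close>

lemma jsl_dfa_transport:
  assumes A: "is_jsl_dfa A" and f: "jsl_dfa_morphism A B f"
    and surj: "jsl_states B = f ` jsl_states A"
    and inv: "\<And>s. s \<in> jsl_states A \<Longrightarrow> g (f s) = s"
    and final: "jsl_final B \<subseteq> jsl_states B"
  shows "is_jsl_dfa B \<and> jsl_dfa_iso A B f g"
proof -
  have jslA: "is_jsl (jsl_states A) (jsl_join A) (jsl_bot A)"
    and homA: "\<And>a. jsl_hom (jsl_states A) (jsl_join A) (jsl_bot A)
                  (jsl_states A) (jsl_join A) (jsl_bot A) (jsl_step A a)"
    and initA: "jsl_init A \<in> jsl_states A"
    and finA: "finite (jsl_states A)"
    using A by (auto simp: is_jsl_dfa_def)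
  have botA: "jsl_bot A \<in> jsl_states A"
    and joinA: "\<And>x y. x \<in> jsl_states A \<Longrightarrow> y \<in> jsl_states A \<Longrightarrow> jsl_join A x y \<in> jsl_states A"
    and assocA: "\<And>x y z. x \<in> jsl_states A \<Longrightarrow> y \<in> jsl_states A \<Longrightarrow> z \<in> jsl_states A \<Longrightarrow>
                   jsl_join A (jsl_join A x y) z = jsl_join A x (jsl_join A y z)"
    and commA: "\<And>x y. x \<in> jsl_states A \<Longrightarrow> y \<in> jsl_states A \<Longrightarrow> jsl_join A x y = jsl_join A y x"
    and idemA: "\<And>x. x \<in> jsl_states A \<Longrightarrow> jsl_join A x x = x"
    and unitA: "\<And>x. x \<in> jsl_states A \<Longrightarrow> jsl_join A (jsl_bot A) x = x"
    using jslA unfolding is_jsl_def by blast+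
  have stepA: "\<And>a x. x \<in> jsl_states A \<Longrightarrow> jsl_step A a x \<in> jsl_states A"
    using homA by (auto simp: jsl_hom_def)
  have f_bot: "jsl_bot B = f (jsl_bot A)"
    and f_join: "\<And>x y. x \<in> jsl_states A \<Longrightarrow> y \<in> jsl_states A \<Longrightarrow>
                   jsl_join B (f x) (f y) = f (jsl_join A x y)"
    and f_init: "jsl_init B = f (jsl_init A)"
    and f_step: "\<And>a x. x \<in> jsl_states A \<Longrightarrow> jsl_step B a (f x) = f (jsl_step A a x)"
    and f_final: "\<And>x. x \<in> jsl_states A \<Longrightarrow> f x \<in> jsl_final B \<longleftrightarrow> x \<in> jsl_final A"
    using f by (auto simp: jsl_dfa_morphism_def jsl_hom_def)
  have finalA: "jsl_final A \<subseteq> jsl_states A"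
    using A by (auto simp: is_jsl_dfa_def)
  have f_inj: "f x = f y \<longleftrightarrow> x = y" if "x \<in> jsl_states A" "y \<in> jsl_states A" for x y
    using inv that by metis
  have jslB: "is_jsl (jsl_states B) (jsl_join B) (jsl_bot B)"
    unfolding is_jsl_def surj f_bot ball_simps
    by (intro conjI ballI) (auto simp: f_join joinA botA assocA idemA unitA intro: arg_cong[OF commA])
  have homB: "jsl_hom (jsl_states B) (jsl_join B) (jsl_bot B)
                 (jsl_states B) (jsl_join B) (jsl_bot B) (jsl_step B a)" for a
    using homA[of a] botA by (simp add: jsl_hom_def surj f_bot f_join f_step joinA)
  obtain t where t: "t \<in> jsl_states A"
    "jsl_final A = {s \<in> jsl_states A. jsl_join A s t \<noteq> t}"
    using A by (auto simp: is_jsl_dfa_def)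
  \<comment> \<open>The left inverse makes \<open>f\<close> injective on states, so
    \<open>jsl_join A x t \<noteq> t\<close> is both preserved and reflected, and \<open>f t\<close>
    takes over the role of \<open>t\<close>.\<close>
  have "jsl_final B = {s \<in> jsl_states B. jsl_join B s (f t) \<noteq> f t}"
  proof (rule set_eqI)
    fix s
    show "s \<in> jsl_final B \<longleftrightarrow> s \<in> {s \<in> jsl_states B. jsl_join B s (f t) \<noteq> f t}"
    proof (cases "s \<in> jsl_states B")
      case True
      then obtain x where x: "x \<in> jsl_states A" "s = f x"
        using surj by auto
      then show ?thesis
        using True t by (simp add: f_final f_join f_inj joinA)
    qed (use final in auto)
  qed
  then have "is_jsl_dfa B"
    using finA jslB homB initA t(1) by (auto simp: is_jsl_dfa_def surj f_init)
  moreover have "jsl_dfa_morphism B A g"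
    using initA botA final finalA
    unfolding jsl_dfa_morphism_def jsl_hom_def surj
    by (auto simp: f_bot f_init f_join f_step joinA stepA inv f_final)
  ultimately show ?thesis
    using f inv by (auto simp: jsl_dfa_iso_def surj)
qed

text \<open>Since \<open>u @ rev v\<close> reverses to \<open>v @ rev u\<close>, the condition says
  that \<open>rev u\<close> lies in the derivative of \<open>reversal L\<close> by \<open>v\<close>;
  only this derivative matters, not \<open>v\<close> itself.\<close>

lemma left_deriv_reversal_eqD:
  assumes "left_deriv v (reversal L) = left_deriv w (reversal L)" "u @ rev v \<in> L"
  shows "u @ rev w \<in> L"
proof -
  have "rev u \<in> left_deriv v (reversal L)"
    using assms(2) by simp
  then show ?thesis
    unfolding assms(1) by simp
qed

text \<open>Membership in \<open>alpha L X\<close> only provides some \<open>w\<close> with the same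
  derivative as \<open>v\<close> and \<open>rev w\<close> in \<open>X\<close>. As \<open>X\<close>
  is a union of derivatives of \<open>L\<close>, each of which contains \<open>rev w\<close> iff it
  contains \<open>rev v\<close>, the choice of \<open>w\<close> is immaterial.\<close>

lemma left_deriv_in_alpha_iff:
  assumes "X \<in> LQ L"
  shows "left_deriv v (reversal L) \<in> alpha L X \<longleftrightarrow> rev v \<in> X"
proof -
  obtain U where "X = left_quot U L"
    using assms by (rule in_LQ_E)
  then show ?thesis
    unfolding alpha_def by (auto simp: left_quot_iff) (metis left_deriv_reversal_eqD)
qed

lemma alpha_left_quot: "alpha L (left_quot U L) = dep_rel L `` ((\<lambda>u. left_deriv u L) ` U)"
proof -
  \<comment> \<open>A pair in \<open>dep_rel L\<close> comes with some representative of its first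
    component; equal derivatives contain the same words \<open>rev v\<close>, so this representative
    can be replaced by \<open>u\<close>.\<close>
  have "(left_deriv u L, Z) \<in> dep_rel L \<longleftrightarrow>
      (\<exists>v. Z = left_deriv v (reversal L) \<and> u @ rev v \<in> L)" for u Z
    unfolding dep_rel_def mem_Collect_eq prod.inject by (metis left_deriv_iff)
  then show ?thesis
    unfolding alpha_def Image_def by (auto simp: left_quot_iff)
qed

lemma Det_states_eq: "{dep_rel L `` A | A. A \<subseteq> LW L} = alpha L ` LQ L"
proof (intro subset_antisym subsetI)
  fix S assume "S \<in> {dep_rel L `` A | A. A \<subseteq> LW L}"
  then obtain A where A: "A \<subseteq> LW L" "S = dep_rel L `` A" by auto
  \<comment> \<open>All representatives of members of \<open>A\<close> together form the set of
    words whose quotient is mapped to \<open>S\<close>.\<close>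
  have "A = (\<lambda>u. left_deriv u L) ` {u. left_deriv u L \<in> A}"
    using A(1) by (auto simp: LW_def)
  then have "S = alpha L (left_quot {u. left_deriv u L \<in> A} L)"
    by (simp add: A(2) alpha_left_quot)
  then show "S \<in> alpha L ` LQ L" by simp
next
  fix S assume "S \<in> alpha L ` LQ L"
  then obtain U where "S = alpha L (left_quot U L)"
    by (auto elim: in_LQ_E)
  then show "S \<in> {dep_rel L `` A | A. A \<subseteq> LW L}"
    by (auto simp: alpha_left_quot intro!: exI[of _ "(\<lambda>u. left_deriv u L) ` U"])
qed

lemma Det_canonical_dep_aut:
  "Det (canonical_dep_aut L) =
     \<lparr> jsl_states = alpha L ` LQ L,
       jsl_join = (\<union>),
       jsl_bot = {},
       jsl_init = {Z \<in> LW (reversal L). [] \<in> Z},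
       jsl_step = (\<lambda>a S. {Z \<in> LW (reversal L). left_deriv [a] Z \<in> S}),
       jsl_final = {S \<in> alpha L ` LQ L. reversal L \<in> S} \<rparr>"
  by (simp add: Det_def canonical_dep_aut_def min_dfa_def Let_def Det_states_eq del: mem_Collect_eq)

lemma alpha_inv_alpha:
  assumes X: "X \<in> LQ L"
  shows "alpha_inv L (alpha L X) = X"
proof -
  \<comment> \<open>The derivatives missing from \<open>alpha L X\<close> are those by some
    \<open>v\<close> with \<open>rev v\<close> outside \<open>X\<close>. Avoiding them all means
    that no word outside \<open>X\<close> continues \<open>u\<close> into \<open>L\<close>.\<close>
  have "rev u \<in> (\<Inter>Z \<in> LW (reversal L) - alpha L X. - Z) \<longleftrightarrow> left_deriv u L \<subseteq> X" for u
  proof -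
    have "rev u \<in> (\<Inter>Z \<in> LW (reversal L) - alpha L X. - Z) \<longleftrightarrow>
        (\<forall>v. rev v \<notin> X \<longrightarrow> u @ rev v \<notin> L)"
    proof -
      have "LW (reversal L) - alpha L X = {left_deriv v (reversal L) | v. rev v \<notin> X}"
        unfolding LW_def using left_deriv_in_alpha_iff[OF X] by blast
      moreover have "rev u \<in> left_deriv v (reversal L) \<longleftrightarrow> u @ rev v \<in> L" for v
        by simp
      ultimately show ?thesis by blast
    qed
    also have "\<dots> \<longleftrightarrow> left_deriv u L \<subseteq> X"
      by (metis left_deriv_iff rev_rev_ident subsetI subsetD)
    finally show ?thesis .
  qed
  then have "alpha_inv L (alpha L X) = left_quot {u. left_deriv u L \<subseteq> X} L"
    unfolding alpha_inv_def left_quot_def by (simp only: reversal_iff Bex_def mem_Collect_eq)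
  \<comment> \<open>If \<open>X\<close> is the quotient by \<open>U\<close>, every word of
    \<open>U\<close> has its derivative inside \<open>X\<close>, and these derivatives already cover
    \<open>X\<close>.\<close>
  also have "\<dots> = X"
  proof -
    obtain U where "X = left_quot U L"
      using X by (rule in_LQ_E)
    then show ?thesis
      unfolding left_quot_eq_Union by blast
  qed
  finally show ?thesis .
qed

text \<open>Deriving \<open>left_deriv v (reversal L)\<close> by \<open>a\<close> appends
  \<open>a\<close> to \<open>v\<close>. Reversal moves this letter to the front of
  \<open>rev v\<close>, where the derivative of \<open>X\<close> by \<open>a\<close> removes
  it.\<close>

lemma alpha_step:
  assumes "X \<in> LQ L"
  shows "alpha L (left_deriv [a] X) = {Z \<in> LW (reversal L). left_deriv [a] Z \<in> alpha L X}"
proof -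
  have "left_deriv [a] (left_deriv v (reversal L)) \<in> alpha L X \<longleftrightarrow> a # rev v \<in> X" for v
    by (simp add: left_deriv_append left_deriv_in_alpha_iff[OF assms])
  then show ?thesis
    unfolding alpha_def[of L "left_deriv [a] X"] LW_def by auto
qed

lemma alpha_morphism: "jsl_dfa_morphism (min_jsl_dfa L) (Det (canonical_dep_aut L)) (alpha L)"
proof -
  \<comment> \<open>\<open>rev v\<close> is in \<open>L\<close> iff the derivative of
    \<open>reversal L\<close> by \<open>v\<close> contains the empty word.\<close>
  have "alpha L L = {Z \<in> LW (reversal L). [] \<in> Z}"
    by (auto simp: alpha_def LW_def)
  moreover have "alpha L (X \<union> Y) = alpha L X \<union> alpha L Y" for X Y
    by (auto simp: alpha_def)
  moreover have "alpha L {} = {}"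
    by (simp add: alpha_def)
  \<comment> \<open>\<open>reversal L\<close> is its own derivative by the empty word.\<close>
  moreover have "reversal L \<in> alpha L X \<longleftrightarrow> [] \<in> X" if "X \<in> LQ L" for X
    using left_deriv_in_alpha_iff[OF that, of "[]"] by simp
  ultimately show ?thesis
    by (auto simp: jsl_dfa_morphism_def jsl_hom_def min_jsl_dfa_def Det_canonical_dep_aut alpha_step)
qed

theorem theorem3p3p10:
  fixes L :: "'a lang"
  assumes "regular L"
  shows "is_jsl_dfa (min_jsl_dfa L) \<and> is_jsl_dfa (Det (canonical_dep_aut L)) \<and>
    jsl_dfa_iso (min_jsl_dfa L) (Det (canonical_dep_aut L)) (alpha L) (alpha_inv L)"
proof -
  have "jsl_states (Det (canonical_dep_aut L)) = alpha L ` jsl_states (min_jsl_dfa L)"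
    by (simp add: Det_canonical_dep_aut min_jsl_dfa_def)
  moreover have "jsl_final (Det (canonical_dep_aut L)) \<subseteq> jsl_states (Det (canonical_dep_aut L))"
    by (auto simp: Det_canonical_dep_aut)
  moreover have "alpha_inv L (alpha L X) = X" if "X \<in> jsl_states (min_jsl_dfa L)" for X
    using that by (simp add: min_jsl_dfa_def alpha_inv_alpha)
  ultimately show ?thesis
    using jsl_dfa_transport[OF is_jsl_dfa_min_jsl_dfa[OF assms] alpha_morphism]
      is_jsl_dfa_min_jsl_dfa[OF assms] by blast
qed

end
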